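(* Let $p$ be a prime, let $H\cong2\cdot\mathrm{S}_4$ be a subgroup of $\mathrm{SL}(2,p)$, and let $x\in\mathrm{SL}(2,p)$ satisfy $\langle H,x\rangle=\mathrm{SL}(2,p)$, $x^2\in H$ and $[H:x^{-1}Hx\cap H]=3$. Let $S=H\cup(xH\cap Hx)$, let $1\ne s\in S$ and $y\in\mathrm{SL}(2,p)\setminus S$, and let $T=(S\setminus\{s,s^{-1}\})\cup\{y,y^{-1}\}$. Then $\Delta(T)>\Delta(S)$.
   Context: For a subset $S$ of $\mathrm{SL}(2,p)$, $S^3=\{abc: a,b,c\in S\}$ and $\Delta(S)=\log(|S^3|)/\log(|S|)$. Here $2\cdot\mathrm{S}_4$ denotes the binary octahedral group of order 48, i.e. the double cover of $\mathrm{S}_4$ occurring as the full preimage in $\mathrm{SL}(2,p)$ of a subgroup $\mathrm{S}_4$ of $\mathrm{PSL}(2,p)$. *)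

theory Defs
  imports
    "HOL-Analysis.Determinants"
    "HOL-Algebra.Coset"
    "HOL-Algebra.Generated_Groups"
    "HOL-Algebra.Sym_Groups"
    "Berlekamp_Zassenhaus.Finite_Field"
begin

definition SL2 :: "('a::field ^ 2 ^ 2) monoid" where
  "SL2 = \<lparr>carrier = {A. det A = 1}, mult = (**), one = mat 1\<rparr>"

definition SL2_scalars :: "('a::field ^ 2 ^ 2) set" where
  "SL2_scalars = {mat 1, - mat 1}"

definition PSL2 :: "('a::field ^ 2 ^ 2) set monoid" where
  "PSL2 = SL2 Mod SL2_scalars"

definition PSL2_preimage :: "('a::field ^ 2 ^ 2) set set \<Rightarrow> ('a ^ 2 ^ 2) set" where
  "PSL2_preimage K = {A \<in> carrier SL2. SL2_scalars #>\<^bsub>SL2\<^esub> A \<in> K}"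

text \<open>
  \<open>H\<close> is isomorphic to the binary octahedral group, the double cover of the symmetric group on
  four letters that arises as the full preimage in \<open>SL(2,F)\<close> of a subgroup \<open>K\<close> of \<open>PSL(2,F)\<close>
  isomorphic to that symmetric group.  Over a field of characteristic 2 there is no double cover,
  since the two scalars coincide; for the field with two elements no such \<open>K\<close> exists.
\<close>
definition is_double_cover_S4 :: "('a::field ^ 2 ^ 2) set \<Rightarrow> bool" where
  "is_double_cover_S4 H \<longleftrightarrow>
     (\<exists>K :: ('a ^ 2 ^ 2) set set. subgroup K PSL2 \<and> PSL2\<lparr>carrier := K\<rparr> \<cong> sym_group 4 \<and>
          SL2\<lparr>carrier := H\<rparr> \<cong> SL2\<lparr>carrier := PSL2_preimage K\<rparr>)"

definition triple_growth :: "('a, 'b) monoid_scheme \<Rightarrow> 'a set \<Rightarrow> real" where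
  "triple_growth G S = ln (real (card (S <#>\<^bsub>G\<^esub> S <#>\<^bsub>G\<^esub> S))) / ln (real (card S))"

lemma SL2_simps [simp]:
  "A \<in> carrier SL2 \<longleftrightarrow> det A = 1"
  "A \<otimes>\<^bsub>SL2\<^esub> B = A ** B"
  "\<one>\<^bsub>SL2\<^esub> = mat 1"
  by (simp_all add: SL2_def)

lemma group_SL2: "group (SL2 :: ('a::field ^ 2 ^ 2) monoid)"
proof (rule groupI)
  fix A :: "'a ^ 2 ^ 2"
  assume "A \<in> carrier SL2"
  then have A: "det A = 1" by simp
  then obtain B where B: "B ** A = mat 1"
    using invertible_det_nz[of A] invertible_def[of A] by auto
  then have "det B = 1"
    using A det_mul[of B A] by simp
  with B show "\<exists>B\<in>carrier SL2. B \<otimes>\<^bsub>SL2\<^esub> A = \<one>\<^bsub>SL2\<^esub>"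
    by auto
qed (auto simp: det_mul matrix_mul_assoc)

lemma normal_SL2_scalars: "SL2_scalars \<lhd> (SL2 :: ('a::field ^ 2 ^ 2) monoid)"
proof -
  interpret group "SL2 :: ('a ^ 2 ^ 2) monoid" by (rule group_SL2)
  have neg_l: "(- mat 1) ** A = - A" and neg_r: "A ** (- mat 1) = - A" for A :: "'a ^ 2 ^ 2"
    by (simp_all add: vec_eq_iff forall_2 matrix_matrix_mult_def mat_def sum_2)
  have det_neg: "det (- mat 1 :: 'a ^ 2 ^ 2) = 1"
    by (simp add: det_2 mat_def)
  have "inv\<^bsub>SL2\<^esub> (- mat 1) = (- mat 1 :: 'a ^ 2 ^ 2)"
    by (rule inv_equality) (simp_all add: det_neg neg_l)
  moreover have "inv\<^bsub>SL2\<^esub> (mat 1) = (mat 1 :: 'a ^ 2 ^ 2)"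
    using inv_one by simp
  ultimately have "subgroup SL2_scalars (SL2 :: ('a ^ 2 ^ 2) monoid)"
    by (intro subgroupI) (auto simp: SL2_scalars_def det_neg neg_l neg_r)
  then show ?thesis
    by (rule normalI) (auto simp: SL2_scalars_def r_coset_def l_coset_def neg_l neg_r)
qed

lemma group_PSL2: "group (PSL2 :: ('a::field ^ 2 ^ 2) set monoid)"
  unfolding PSL2_def by (rule normal.factorgroup_is_group[OF normal_SL2_scalars])

end

theory Submission
  imports Defs
begin

text \<open>
  Let \<open>L = x\<inverse>Hx \<inter> H\<close> and \<open>N = L \<union> xL\<close>. Since \<open>x\<^sup>2 \<in> H\<close>, the element \<open>x\<close> normalizes \<open>L\<close>,
  so \<open>N\<close> is a group, \<open>xL = xH \<inter> Hx\<close>, and \<open>S = H \<union> N\<close> where \<open>|H| = 48\<close>, \<open>|N| = 32\<close> and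
  \<open>|H \<inter> N| = |L| = 16\<close>. The cosets \<open>gH\<close>, with \<open>gH\<close> joined to \<open>gtH\<close> for \<open>t \<in> N - H\<close>, form a connected
  cubic graph on which the whole group acts; \<open>H\<close> is the stabilizer of a vertex \<open>v\<close> and \<open>N\<close> that of an
  edge at \<open>v\<close>.  In this picture \<open>HNH\<close> consists of the elements moving \<open>v\<close> by distance at most one, and
  every element of \<open>NHN\<close> moves \<open>v\<close> by distance at most two.

  Words of length three in \<open>H \<union> N\<close> lie in \<open>HNH\<close> or in \<open>NHN\<close>, and counting cosets gives
  \<open>|HNH| \<le> 192\<close> and \<open>|NHN - HNH| \<le> 32\<close>; so \<open>|S\<^sup>3| \<le> 224\<close>, while \<open>|S| = 64\<close>
  (\<open>card_triple_product\<close>, \<open>card_union\<close>).  Exchanging \<open>s\<^sup>\<plusminus>\<^sup>1\<close> for \<open>y\<^sup>\<plusminus>\<^sup>1\<close> loses nothing: each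
  element of \<open>S\<^sup>3\<close> is a triple product in so many ways that one of them avoids \<open>s\<close> and \<open>s\<inverse>\<close>. It gains
  something as soon as a product \<open>g\<close> of two elements of \<open>T\<close> lies outside \<open>HNH\<close>: then at least 46
  elements of the coset \<open>Hg\<close> are in \<open>T\<^sup>3\<close>, all are outside \<open>HNH\<close>, and at most 32 elements of \<open>S\<^sup>3\<close> are.  Hence
  \<open>|T\<^sup>3| \<ge> |S\<^sup>3| + 14\<close> (\<open>triple_product_exchange\<close>), which outweighs the possible growth of
  \<open>|T|\<close> from 64 to 65 (\<open>ln_ratio_less\<close>).

  The required \<open>g\<close> is \<open>y\<close> itself, unless \<open>y\<close> moves \<open>v\<close> to a neighbour. In that case \<open>ty\<close> or \<open>ty\<inverse>\<close>
  moves \<open>v\<close> to a vertex reached from \<open>v\<close> by a path of length two without backtracking, and this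
  vertex is not a neighbour of \<open>v\<close> because the graph has no triangles
  (\<open>no_triangle\<close>): an arc-transitive connected cubic graph with a triangle is the complete graph on
  four vertices, which would force the group to equal \<open>HNH\<close> and to have at most 192 elements.  For
  \<open>SL(2,p)\<close> this is excluded, because its order is divisible by \<open>p\<close> and by 96 (\<open>order_SL2_gt_192\<close>).
\<close>

section \<open>Counting and cancellation\<close>

lemma mult_card_image_le:
  assumes "finite A" and "\<And>y. y \<in> f ` A \<Longrightarrow> k \<le> card {x \<in> A. f x = y}"
  shows "k * card (f ` A) \<le> card A"
proof -
  have "k * card (f ` A) = (\<Sum>y\<in>f ` A. k)" by simp
  also have "\<dots> \<le> (\<Sum>y\<in>f ` A. card {x \<in> A. f x = y})"
    by (rule sum_mono) (rule assms(2))
  also have "\<dots> = card A"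
    using sum.image_gen[OF assms(1), of "\<lambda>_. 1::nat" f] by simp
  finally show ?thesis .
qed

lemma exists_outside_four:
  assumes "4 < card A"
  shows "\<exists>l\<in>A. l \<noteq> a \<and> l \<noteq> b \<and> l \<noteq> c \<and> l \<noteq> d"
proof (rule ccontr)
  assume "\<not> ?thesis"
  then have "A \<subseteq> set [a, b, c, d]" by auto
  then have "card A \<le> card (set [a, b, c, d])" by (intro card_mono) auto
  also have "\<dots> \<le> 4" using card_length[of "[a, b, c, d]"] by simp
  finally show False using assms by simp
qed

lemma (in group) inv_cancel_left [simp]:
  assumes "a \<in> carrier G" "b \<in> carrier G"
  shows "inv a \<otimes> (a \<otimes> b) = b" "a \<otimes> (inv a \<otimes> b) = b"
  using assms by (simp_all flip: m_assoc)

lemma (in group) mult_eq_mult_assoc: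
  assumes "a \<otimes> b = c \<otimes> d" "a \<in> carrier G" "b \<in> carrier G" "c \<in> carrier G" "d \<in> carrier G" "z \<in> carrier G"
  shows "a \<otimes> (b \<otimes> z) = c \<otimes> (d \<otimes> z)"
  using assms by (simp flip: m_assoc)

lemma (in group) lagrange_within:
  assumes "subgroup A G" "subgroup H G" "A \<subseteq> H"
  shows "card (rcosets\<^bsub>G\<lparr>carrier := H\<rparr>\<^esub> A) * card A = card H"
  using group.lagrange[OF subgroup_imp_group[OF assms(2)] subgroup_incl[OF assms]]
  by (simp add: Coset.order_def)

section \<open>Amalgams acting on a cubic graph\<close>

text \<open>
  The orders are those of the stabilizers of a vertex, of an edge and of an arc in the cubic graph.
  The index of \<open>H \<inter> N\<close> in \<open>H\<close> is the valency 3, and its index 2 in \<open>N\<close> accounts for the reversal of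
  an edge.
\<close>
locale cubic_amalgam = group +
  fixes H N
  assumes subgroup_H: "subgroup H G" and subgroup_N: "subgroup N G"
    and card_H: "card H = 48" and card_N: "card N = 32" and card_HN: "card (H \<inter> N) = 16"
begin

text \<open>
  The elements of \<open>near\<close> move the base vertex \<open>H\<close> by distance at most one, those of \<open>far\<close> by at most two.
\<close>
definition near where "near = H <#> N <#> H"
definition far where "far = N <#> H <#> N"

lemma finite_H: "finite H" and finite_N: "finite N"
  using card_H card_N by (auto intro: card_ge_0_finite)

lemma H_closed [simp, intro]:
  "a \<in> H \<Longrightarrow> a \<in> carrier G" "a \<in> H \<Longrightarrow> b \<in> H \<Longrightarrow> a \<otimes> b \<in> H" "a \<in> H \<Longrightarrow> inv a \<in> H" "\<one> \<in> H"
  using subgroup_H by (auto intro: subgroup.mem_carrier subgroup.m_closed subgroup.m_inv_closed subgroup.one_closed)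

lemma N_closed [simp, intro]:
  "a \<in> N \<Longrightarrow> a \<in> carrier G" "a \<in> N \<Longrightarrow> b \<in> N \<Longrightarrow> a \<otimes> b \<in> N" "a \<in> N \<Longrightarrow> inv a \<in> N" "\<one> \<in> N"
  using subgroup_N by (auto intro: subgroup.mem_carrier subgroup.m_closed subgroup.m_inv_closed subgroup.one_closed)

lemma mult_notin_H:
  assumes "l \<in> H" "t \<in> carrier G" "t \<notin> H"
  shows "l \<otimes> t \<notin> H" "t \<otimes> l \<notin> H"
proof -
  have "inv l \<otimes> (l \<otimes> t) = t" "t \<otimes> l \<otimes> inv l = t"
    using assms by (simp_all add: m_assoc)
  then show "l \<otimes> t \<notin> H" "t \<otimes> l \<notin> H"
    using assms H_closed(2,3) by metis+
qed

lemma inv_notin_H: "t \<in> carrier G \<Longrightarrow> t \<notin> H \<Longrightarrow> inv t \<notin> H"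
  using H_closed(3)[of "inv t"] by auto

lemma card_diffs: "card (N - H) = 16" "card (H - N) = 32"
  using card_Diff_subset_Int[of N H] card_Diff_subset_Int[of H N] card_H card_N card_HN finite_H finite_N
  by (simp_all add: Int_commute)

text \<open>
  As \<open>H \<inter> N\<close> has index 2 in \<open>N\<close>, all edge-reversing elements form one coset of it, on either side.
\<close>
lemma diff_eq_coset:
  assumes "t \<in> N - H"
  shows "(\<lambda>l. t \<otimes> l) ` (H \<inter> N) = N - H"
proof (rule card_subset_eq)
  show "(\<lambda>l. t \<otimes> l) ` (H \<inter> N) \<subseteq> N - H"
    using assms mult_notin_H by auto
  have "inj_on (\<lambda>l. t \<otimes> l) (H \<inter> N)"
    using assms by (auto simp: inj_on_def)
  then show "card ((\<lambda>l. t \<otimes> l) ` (H \<inter> N)) = card (N - H)"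
    by (simp add: card_image card_HN card_diffs)
qed (simp add: finite_N)

lemma diff_right:
  assumes "t \<in> N - H" "u \<in> N - H"
  obtains l where "l \<in> H \<inter> N" "u = t \<otimes> l"
  using diff_eq_coset[OF assms(1)] assms(2) by blast

lemma diff_left:
  assumes "t \<in> N - H" "u \<in> N - H"
  obtains l where "l \<in> H \<inter> N" "u = l \<otimes> t"
proof -
  have "inv t \<in> N - H" "inv u \<in> N - H" using assms inv_notin_H by auto
  then obtain l where l: "l \<in> H \<inter> N" "inv u = inv t \<otimes> l" by (rule diff_right)
  then have "inv (inv u) = inv l \<otimes> t" using assms by (simp add: inv_mult_group)
  then have "u = inv l \<otimes> t" using assms by simp
  with l that show thesis by blast
qed

lemma obtain_t: obtains t where "t \<in> N - H"
proof -
  have "N - H \<noteq> {}" using card_diffs by (metis card.empty zero_neq_numeral)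
  then show thesis using that by blast
qed

lemma near_iff: "z \<in> near \<longleftrightarrow> (\<exists>a\<in>H. \<exists>n\<in>N. \<exists>b\<in>H. z = a \<otimes> n \<otimes> b)"
  by (auto simp: near_def set_mult_def)

lemma far_iff: "z \<in> far \<longleftrightarrow> (\<exists>a\<in>N. \<exists>n\<in>H. \<exists>b\<in>N. z = a \<otimes> n \<otimes> b)"
  by (auto simp: far_def set_mult_def)

lemma near_I: "a \<in> H \<Longrightarrow> n \<in> N \<Longrightarrow> b \<in> H \<Longrightarrow> a \<otimes> n \<otimes> b \<in> near"
  by (auto simp: near_iff)

lemma near_carrier: "z \<in> near \<Longrightarrow> z \<in> carrier G"
  by (auto simp: near_iff)

lemma near_mult_left: "a \<in> H \<Longrightarrow> z \<in> near \<Longrightarrow> a \<otimes> z \<in> near"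
  unfolding near_iff by (metis H_closed(1,2) N_closed(1) m_assoc m_closed)

lemma near_mult_right: "a \<in> H \<Longrightarrow> z \<in> near \<Longrightarrow> z \<otimes> a \<in> near"
  unfolding near_iff by (metis H_closed(1,2) N_closed(1) m_assoc m_closed)

lemma near_mult_left_iff: "a \<in> H \<Longrightarrow> z \<in> carrier G \<Longrightarrow> a \<otimes> z \<in> near \<longleftrightarrow> z \<in> near"
  by (metis H_closed(1,3) inv_cancel_left(1) near_mult_left)

lemma near_mult_right_iff: "a \<in> H \<Longrightarrow> z \<in> carrier G \<Longrightarrow> z \<otimes> a \<in> near \<longleftrightarrow> z \<in> near"
  by (metis H_closed(1,3) inv_solve_right' near_mult_right m_closed)

lemma near_inv: "z \<in> near \<Longrightarrow> inv z \<in> near"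
  unfolding near_iff by (force simp: inv_mult_group m_assoc)

lemma H_near: "H \<subseteq> near"
  using near_I[of _ \<one> \<one>] by force

lemma HN_near: "a \<in> H \<Longrightarrow> n \<in> N \<Longrightarrow> a \<otimes> n \<in> near"
  using near_I[of a n \<one>] by force

lemma NH_near: "a \<in> H \<Longrightarrow> n \<in> N \<Longrightarrow> n \<otimes> a \<in> near"
  using near_I[of \<one> n a] by force

lemma N_near: "N \<subseteq> near"
  using HN_near[of \<one>] by force

lemma near_cases:
  assumes "z \<in> near" "t \<in> N - H"
  obtains "z \<in> H" | a b where "a \<in> H" "b \<in> H" "z = a \<otimes> t \<otimes> b"
proof -
  obtain a n b where z: "a \<in> H" "n \<in> N" "b \<in> H" "z = a \<otimes> n \<otimes> b"
    using assms(1) by (auto simp: near_iff)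
  show thesis
  proof (cases "n \<in> H")
    case True
    then show thesis using z that by auto
  next
    case False
    then obtain l where "l \<in> H \<inter> N" "n = l \<otimes> t" using z assms diff_left by blast
    then show thesis using z assms that(2)[of "a \<otimes> l" b] by (auto simp: m_assoc)
  qed
qed

lemma finite_near: "finite near"
  unfolding near_def set_mult_def using finite_H finite_N by auto

text \<open>
  Each of the three neighbours of the base vertex is the image of it under 48 elements.  In terms of products:
  for \<open>t \<in> N - H\<close> every element \<open>a \<otimes> t \<otimes> b\<close> of \<open>HtH\<close> can be rewritten in 16 ways by moving an element
  of \<open>H \<inter> N\<close> across \<open>t\<close>.
\<close>
lemma card_near: "card near \<le> 192"
proof -
  obtain t where t: "t \<in> N - H" by (rule obtain_t)
  let ?f = "\<lambda>(a, b). a \<otimes> t \<otimes> b"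
  have "16 * card (?f ` (H \<times> H)) \<le> card (H \<times> H)"
  proof (rule mult_card_image_le)
    fix y assume "y \<in> ?f ` (H \<times> H)"
    then obtain a b where ab: "a \<in> H" "b \<in> H" "y = a \<otimes> t \<otimes> b" by auto
    let ?F = "{x \<in> H \<times> H. ?f x = y}"
    let ?g = "\<lambda>l. (a \<otimes> (t \<otimes> l \<otimes> inv t), inv l \<otimes> b)"
    have "?g l \<in> ?F" if l: "l \<in> H \<inter> N" for l
    proof -
      have "t \<otimes> l \<in> N - H" using l t mult_notin_H by auto
      then obtain k where k: "k \<in> H \<inter> N" "t \<otimes> l = k \<otimes> t" using t diff_left by blast
      then have "t \<otimes> l \<otimes> inv t = k" using t by (simp add: m_assoc)
      moreover have "k \<otimes> (t \<otimes> (inv l \<otimes> b)) = t \<otimes> (l \<otimes> (inv l \<otimes> b))"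
        using k l t ab by (intro mult_eq_mult_assoc) auto
      then have "a \<otimes> k \<otimes> t \<otimes> (inv l \<otimes> b) = y"
        using ab k l t by (simp add: m_assoc)
      ultimately show ?thesis using ab k l t by simp
    qed
    then have "?g ` (H \<inter> N) \<subseteq> ?F" by blast
    moreover have "inj_on ?g (H \<inter> N)"
      using ab by (auto simp: inj_on_def)
    ultimately show "16 \<le> card ?F"
      unfolding card_HN[symmetric] using finite_H by (intro card_inj_on_le) auto
  qed (simp add: finite_H)
  then have "card (?f ` (H \<times> H)) \<le> 144" by (simp add: card_cartesian_product card_H)
  moreover have "near \<subseteq> H \<union> ?f ` (H \<times> H)"
    using near_cases[OF _ t] by (force simp: image_iff)
  then have "card near \<le> card (H \<union> ?f ` (H \<times> H))"
    using finite_H by (intro card_mono) auto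
  ultimately show ?thesis
    using card_Un_le[of H "?f ` (H \<times> H)"] card_H by linarith
qed

text \<open>
  In a product \<open>n \<otimes> h \<otimes> n'\<close> outside \<open>near\<close> both outer factors reverse the edge, so both can be
  replaced by one fixed \<open>t\<close> at the expense of changing \<open>h\<close>.
\<close>
lemma far_diff_near:
  assumes t: "t \<in> N - H" and z: "z \<in> far - near"
  obtains h where "h \<in> H - N" "z = t \<otimes> h \<otimes> t"
proof -
  obtain n h n' where n: "n \<in> N" "h \<in> H" "n' \<in> N" "z = n \<otimes> h \<otimes> n'"
    using z by (auto simp: far_iff)
  have "n \<notin> H" using n z HN_near[of "n \<otimes> h" n'] by auto
  moreover have "n' \<notin> H" using n z NH_near[of "h \<otimes> n'" n] by (auto simp: m_assoc)
  ultimately have nn: "n \<in> N - H" "n' \<in> N - H" using n by auto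
  obtain l where l: "l \<in> H \<inter> N" "n = t \<otimes> l" using t nn(1) by (rule diff_right)
  obtain k where k: "k \<in> H \<inter> N" "n' = k \<otimes> t" using t nn(2) by (rule diff_left)
  note lk = l k
  have eq: "z = t \<otimes> (l \<otimes> h \<otimes> k) \<otimes> t" using n lk t by (simp add: m_assoc)
  moreover have "l \<otimes> h \<otimes> k \<in> H" using n lk by simp
  moreover have "l \<otimes> h \<otimes> k \<notin> N" using z t N_near by (auto simp: eq)
  ultimately show thesis using that by blast
qed

lemma card_far_diff_near: "card (far - near) \<le> 32" and finite_far: "finite far"
proof -
  obtain t where t: "t \<in> N - H" by (rule obtain_t)
  have "far - near \<subseteq> (\<lambda>h. t \<otimes> h \<otimes> t) ` (H - N)"
    using far_diff_near[OF t] by blast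
  then show "card (far - near) \<le> 32"
    using surj_card_le[of "H - N" "far - near"] card_diffs finite_H by simp
  show "finite far" unfolding far_def set_mult_def using finite_H finite_N by auto
qed

lemma triple_product: "(H \<union> N) <#> (H \<union> N) <#> (H \<union> N) \<subseteq> near \<union> far"
proof
  fix z assume "z \<in> (H \<union> N) <#> (H \<union> N) <#> (H \<union> N)"
  then obtain a b c where abc: "a \<in> H \<union> N" "b \<in> H \<union> N" "c \<in> H \<union> N" "z = a \<otimes> b \<otimes> c"
    by (auto simp: set_mult_def)
  show "z \<in> near \<union> far"
  proof (cases "b \<in> H")
    case True
    then show ?thesis
      using abc HN_near[of "a \<otimes> b" c] NH_near[of "b \<otimes> c" a] H_near 
      by (cases "a \<in> H"; cases "c \<in> H") (auto simp: far_iff m_assoc)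
  next
    case False
    then have "b \<in> N" using abc by auto
    then show ?thesis
      using abc HN_near[of a "b \<otimes> c"] NH_near[of c "a \<otimes> b"] N_near near_I[of a b c]
      by (cases "a \<in> H"; cases "c \<in> H") (auto simp: m_assoc)
  qed
qed

text \<open>
  Since \<open>(HNH)(HNH) = H(NHN)H\<close>, closure of \<open>near\<close> under products is only a matter of \<open>far\<close>.
\<close>
lemma subgroup_near:
  assumes "far \<subseteq> near"
  shows "subgroup near G"
proof (rule subgroupI)
  fix z w assume "z \<in> near" "w \<in> near"
  then obtain a n b c m d where
    zw: "a \<in> H" "n \<in> N" "b \<in> H" "z = a \<otimes> n \<otimes> b" "c \<in> H" "m \<in> N" "d \<in> H" "w = c \<otimes> m \<otimes> d"
    by (auto simp: near_iff)
  have "n \<otimes> (b \<otimes> c) \<otimes> m \<in> near" 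
  proof (rule subsetD[OF assms])
    show "n \<otimes> (b \<otimes> c) \<otimes> m \<in> far"
      using zw unfolding far_iff by blast
  qed
  then have "a \<otimes> (n \<otimes> (b \<otimes> c) \<otimes> m) \<otimes> d \<in> near"
    using zw near_mult_left near_mult_right by blast
  then show "z \<otimes> w \<in> near" using zw by (simp add: m_assoc)
qed (use near_inv near_carrier H_near in auto)

lemma carrier_eq_near:
  assumes "far \<subseteq> near" "generate G (H \<union> N) = carrier G"
  shows "carrier G = near"
proof
  show "near \<subseteq> carrier G" using near_carrier by auto
  show "carrier G \<subseteq> near"
    using generate_subgroup_incl[OF _ subgroup_near[OF assms(1)], of "H \<union> N"] assms(2) H_near N_near
    by simp
qed

text \<open>
  A triangle through the base vertex \<open>v\<close> would make two neighbours of \<open>v\<close> adjacent. The set \<open>A\<close> below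
  consists of those \<open>a \<in> H\<close> which move the neighbour \<open>tv\<close> to itself or to a vertex adjacent to it.  If not all three
  neighbours are pairwise adjacent, then \<open>A\<close> is a union of exactly two of the three cosets of
  \<open>H \<inter> N\<close> in \<open>H\<close>; being closed under inversion, it is then a subgroup of order 32 in a group of
  order 48, against Lagrange.
\<close>
lemma no_triangle:
  assumes nf: "\<not> far \<subseteq> near" and "t \<in> N - H" "u \<in> N - H" "h \<in> H - N"
  shows "t \<otimes> h \<otimes> u \<notin> near"
proof
  assume "t \<otimes> h \<otimes> u \<in> near"
  \<comment> \<open>Absorbing \<open>k\<close> into the middle factor allows both outer factors to be \<open>t\<close>.\<close>
  obtain k where k: "k \<in> H \<inter> N" "u = k \<otimes> t" using assms diff_left by blast
  define A where "A = {a \<in> H. t \<otimes> a \<otimes> t \<in> near}"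
  have t: "t \<in> carrier G" "t \<in> N" "t \<notin> H" using assms by auto
  have finA: "finite A" using finite_H by (auto simp: A_def)
  have A_H: "a \<in> H" if "a \<in> A" for a using that by (simp add: A_def)
  have A_right: "a \<otimes> l \<in> A" if "a \<in> A" "l \<in> H \<inter> N" for a l
  proof -
    have "l \<otimes> t \<in> N - H" using that t mult_notin_H by auto
    then obtain m where m: "m \<in> H \<inter> N" "l \<otimes> t = t \<otimes> m" using diff_right[of t] assms by blast
    have "t \<otimes> (a \<otimes> l) \<otimes> t = t \<otimes> a \<otimes> (l \<otimes> t)" using that t A_H by (simp add: m_assoc)
    also have "\<dots> = t \<otimes> a \<otimes> t \<otimes> m" unfolding m(2) using that t A_H m by (simp add: m_assoc)
    finally show ?thesis using that m near_mult_right[of m] by (auto simp: A_def)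
  qed
  have A_inv: "inv a \<in> A" if "a \<in> A" for a
  proof -
    \<comment> \<open>Inverting \<open>t \<otimes> a \<otimes> t\<close> yields \<open>inv a\<close> between two copies of \<open>inv t\<close>, which are again translates of \<open>t\<close>.\<close>
    have t': "t \<in> N - H" "inv t \<in> N - H" using t inv_notin_H by auto
    obtain l where l: "l \<in> H \<inter> N" "inv t = l \<otimes> t" using t' by (rule diff_left)
    obtain m where m: "m \<in> H \<inter> N" "inv t = t \<otimes> m" using t' by (rule diff_right)
    note lm = l m
    have "inv t \<otimes> inv a \<otimes> inv t \<in> near"
    proof -
      have "inv (t \<otimes> a \<otimes> t) = inv t \<otimes> inv a \<otimes> inv t"
        using that t A_H by (simp add: inv_mult_group m_assoc)
      then show ?thesis using near_inv[of "t \<otimes> a \<otimes> t"] that by (simp add: A_def)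
    qed
    moreover have "inv t \<otimes> inv a \<otimes> inv t = l \<otimes> t \<otimes> inv a \<otimes> (t \<otimes> m)"
      by (metis lm(2) lm(4))
    ultimately have "l \<otimes> (t \<otimes> inv a \<otimes> t \<otimes> m) \<in> near"
      using lm(1,3) t that A_H by (simp add: m_assoc)
    then show ?thesis
      using lm(1,3) t A_H[OF that] by (simp add: A_def near_mult_left_iff near_mult_right_iff)
  qed
  have A_left: "l \<otimes> a \<in> A" if "a \<in> A" "l \<in> H \<inter> N" for a l
    using A_inv[OF A_right[OF A_inv[OF that(1)], of "inv l"]] that A_H by (simp add: inv_mult_group)
  have L_A: "H \<inter> N \<subseteq> A"
    using t N_near by (auto simp: A_def)
  have hA: "h \<in> A"
  proof -
    have "t \<otimes> h \<otimes> u = t \<otimes> (h \<otimes> k) \<otimes> t" using k assms by (simp add: m_assoc)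
    then have "h \<otimes> k \<in> A" using \<open>t \<otimes> h \<otimes> u \<in> near\<close> assms k by (auto simp: A_def)
    then have "h \<otimes> k \<otimes> inv k \<in> A" using k(1) by (intro A_right[of "h \<otimes> k" "inv k"]) auto
    moreover have "h \<otimes> k \<otimes> inv k = h" using k(1) assms by (simp add: m_assoc)
    ultimately show ?thesis by simp
  qed
  have coset_card: "card ((\<lambda>l. a \<otimes> l) ` (H \<inter> N)) = 16" if "a \<in> H" for a
    using that by (subst card_image) (auto simp: inj_on_def card_HN)
  have "A \<noteq> H"
  proof
    assume "A = H"
    have False if z: "z \<in> far - near" for z
    proof -
      obtain b where "b \<in> H" "z = t \<otimes> b \<otimes> t" using far_diff_near[of t z] z t by blast
      moreover have "b \<in> A" using \<open>A = H\<close> \<open>b \<in> H\<close> by simp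
      ultimately show False using z unfolding A_def by blast
    qed
    with nf show False by blast
  qed
  then obtain c where c: "c \<in> H" "c \<notin> A" using A_H by blast
  have cA: "(\<lambda>l. c \<otimes> l) ` (H \<inter> N) \<inter> A = {}"
  proof -
    have False if "c \<otimes> l \<in> A" "l \<in> H \<inter> N" for l
      using A_right[OF that(1), of "inv l"] that c by (simp add: m_assoc)
    then show ?thesis by blast
  qed
  have card_A: "card A \<le> 32"
  proof -
    have "card ((\<lambda>l. c \<otimes> l) ` (H \<inter> N)) + card A = card ((\<lambda>l. c \<otimes> l) ` (H \<inter> N) \<union> A)"
      using cA finA finite_H by (subst card_Un_disjoint) auto
    also have "\<dots> \<le> card H"
      using c A_H finite_H by (intro card_mono) auto
    finally show ?thesis using coset_card[OF c(1)] card_H by simp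
  qed
  have card_two_cosets: "card ((\<lambda>l. a \<otimes> l) ` (H \<inter> N) \<union> (H \<inter> N)) = 32" if a: "a \<in> A - N" for a
  proof -
    have "a \<otimes> l \<notin> N" if "l \<in> H \<inter> N" for l
    proof
      assume "a \<otimes> l \<in> N"
      then have "a \<otimes> l \<otimes> inv l \<in> N" using that N_closed(2)[of "a \<otimes> l" "inv l"] by blast
      moreover have "a \<otimes> l \<otimes> inv l = a" using a that A_H by (simp add: m_assoc)
      ultimately show False using a by simp
    qed
    then show ?thesis
      using finite_H a A_H coset_card[of a] by (subst card_Un_disjoint) (auto simp: card_HN)
  qed
  have two_cosets: "(\<lambda>l. a \<otimes> l) ` (H \<inter> N) \<union> (H \<inter> N) = A" if a: "a \<in> A - N" for a
  proof (rule card_seteq)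
    show "(\<lambda>l. a \<otimes> l) ` (H \<inter> N) \<union> (H \<inter> N) \<subseteq> A" using L_A A_right a by auto
    show "card A \<le> card ((\<lambda>l. a \<otimes> l) ` (H \<inter> N) \<union> (H \<inter> N))"
      using card_A card_two_cosets[OF a] by simp
  qed (rule finA)
  have A_mult: "a \<otimes> b \<in> A" if ab: "a \<in> A" "b \<in> A" for a b
  proof (cases "a \<in> N \<or> b \<in> N")
    case True
    then show ?thesis using ab A_left A_right A_H by blast
  next
    case False
    have "inv a \<in> A" "inv a \<notin> N" using False ab A_inv A_H N_closed(3)[of "inv a"] by auto
    moreover have "inv a \<in> (\<lambda>l. b \<otimes> l) ` (H \<inter> N) \<union> (H \<inter> N)"
      using two_cosets[of b] False ab \<open>inv a \<in> A\<close> by simp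
    \<comment> \<open>\<open>A - N\<close> is a single coset containing both \<open>b\<close> and \<open>inv a\<close>, so \<open>a \<otimes> b\<close> lies in \<open>H \<inter> N\<close>.\<close>
    ultimately obtain l where l: "l \<in> H \<inter> N" "inv a = b \<otimes> l" by auto
    have "a \<otimes> b \<otimes> l = a \<otimes> inv a" using l ab A_H by (simp add: m_assoc)
    also have "\<dots> = \<one>" using ab A_H by simp
    finally have "a \<otimes> b = inv l"
      using l ab A_H by (intro inv_equality[symmetric]) auto
    then have "a \<otimes> b \<in> H \<inter> N" using l by simp
    then show ?thesis using L_A by auto
  qed
  have "subgroup A G"
    using A_mult A_inv A_H hA by (intro subgroupI) auto
  then have "card A dvd card H"
    using lagrange_within[of A H] subgroup_H A_H by (metis dvd_triv_right subsetI)
  moreover have "card A = 32"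
    using card_two_cosets[of h] two_cosets[of h] hA assms by simp
  ultimately show False using card_H by simp
qed


section \<open>Exchanging an inverse pair\<close>

text \<open>
  An element with more than four factorizations of the form \<open>(a \<otimes> tlt\<inverse>) \<otimes> t \<otimes> (l\<inverse> \<otimes> b)\<close> has one
  whose outer factors differ from \<open>s\<close> and \<open>s\<inverse>\<close>: each outer factor excludes at most two values of \<open>l\<close>.
\<close>
lemma four_translates_avoided:
  assumes "4 < card A" "A \<subseteq> carrier G" "s \<in> carrier G" "a \<in> carrier G" "b \<in> carrier G" "t \<in> carrier G"
  shows "\<exists>l\<in>A. a \<otimes> (t \<otimes> l \<otimes> inv t) \<notin> {s, inv s} \<and> inv l \<otimes> b \<notin> {s, inv s}"
proof -
  obtain l where l: "l \<in> A" "l \<noteq> inv t \<otimes> (inv a \<otimes> (s \<otimes> t))" "l \<noteq> inv t \<otimes> (inv a \<otimes> (inv s \<otimes> t))"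
      "l \<noteq> b \<otimes> inv s" "l \<noteq> b \<otimes> s"
    using exists_outside_four[OF assms(1)] by blast
  have "l \<in> carrier G" using l assms by auto
  have left: "l = inv t \<otimes> (inv a \<otimes> (r \<otimes> t))" if "a \<otimes> (t \<otimes> l \<otimes> inv t) = r" for r
    unfolding that[symmetric] using assms \<open>l \<in> carrier G\<close> by (simp add: m_assoc)
  have right: "l = b \<otimes> inv r" if "inv l \<otimes> b = r" for r
    unfolding that[symmetric] using assms \<open>l \<in> carrier G\<close> by (simp add: inv_mult_group)
  show ?thesis
    using l left right[of s] right[of "inv s"] assms by (intro bexI[of _ l]) auto
qed

text \<open>
  If \<open>y\<close> moves the base vertex \<open>v\<close> to a neighbour other than \<open>tv\<close>, then the path \<open>v, tv, tyv\<close> does not backtrack, and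
  \<open>t \<otimes> y\<close> is outside \<open>near\<close> by the absence of triangles. If \<open>y\<close> and \<open>inv y\<close> both moved \<open>v\<close> to \<open>tv\<close>,
  then \<open>y\<close> would reverse the edge from \<open>v\<close> to \<open>tv\<close> and lie in \<open>N\<close>.
\<close>
lemma product_outside_near:
  assumes nf: "\<not> far \<subseteq> near" and t: "t \<in> N - H" and y: "y \<in> carrier G" "y \<notin> H \<union> N"
  obtains a b where "a \<in> {\<one>, t}" "b \<in> {y, inv y}" "a \<otimes> b \<in> carrier G - near"
proof (cases "y \<in> near")
  case False
  then show thesis using that[of \<one> y] y by simp
next
  case True
  have key: "t \<otimes> z \<notin> near" if z: "z \<in> near" "inv t \<otimes> z \<notin> H" "z \<notin> H" for z
  proof -
    obtain a b where ab: "a \<in> H" "b \<in> H" "z = a \<otimes> t \<otimes> b"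
      using near_cases[OF z(1) t] z(3) by metis
    have "a \<notin> N"
    proof
      assume "a \<in> N"
      then have "a \<otimes> t \<in> N - H" using ab t mult_notin_H by auto
      then obtain l where l: "l \<in> H \<inter> N" "a \<otimes> t = t \<otimes> l" using t diff_right by blast
      have "inv t \<otimes> z = l \<otimes> b" unfolding ab(3) l(2) using l(1) t ab by (simp add: m_assoc)
      then show False using z l ab by auto
    qed
    then have "t \<otimes> a \<otimes> t \<notin> near" using no_triangle[OF nf t t] ab by auto
    moreover have "t \<otimes> z = t \<otimes> a \<otimes> t \<otimes> b" using ab t by (simp add: m_assoc)
    ultimately show ?thesis using ab t near_mult_right_iff[of b "t \<otimes> a \<otimes> t"] by auto
  qed
  have "inv t \<otimes> y \<notin> H \<or> inv t \<otimes> inv y \<notin> H"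
  proof (rule ccontr)
    assume "\<not> ?thesis"
    then have h: "inv t \<otimes> y \<in> H" "inv t \<otimes> inv y \<in> H" by auto
    have "inv t \<otimes> y \<notin> N"
    proof
      assume "inv t \<otimes> y \<in> N"
      then have "t \<otimes> (inv t \<otimes> y) \<in> N" using t N_closed(2)[of t "inv t \<otimes> y"] by blast
      moreover have "t \<otimes> (inv t \<otimes> y) = y" using t y by simp
      ultimately show False using y by simp
    qed
    then have "t \<otimes> (inv t \<otimes> y) \<otimes> t \<notin> near" using no_triangle[OF nf t t] h by auto
    then have "y \<otimes> t \<notin> near" using t y by simp
    moreover have "y \<otimes> t = inv (inv t \<otimes> inv y)" using t y by (simp add: inv_mult_group)
    ultimately show False using h H_near by auto
  qed
  then show thesis
    using key[of y] key[of "inv y"] that[of t y] that[of t "inv y"] True y t near_inv inv_notin_H by auto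
qed

lemma card_triple_product: "card ((H \<union> N) <#> (H \<union> N) <#> (H \<union> N)) \<le> 224"
proof -
  have "card ((H \<union> N) <#> (H \<union> N) <#> (H \<union> N)) \<le> card (near \<union> (far - near))"
    using triple_product finite_near finite_far by (intro card_mono) auto
  also have "\<dots> \<le> 192 + 32"
    using card_Un_le[of near "far - near"] card_near card_far_diff_near by linarith
  finally show ?thesis by simp
qed

lemma card_union: "card (H \<union> N) = 64"
  using card_Un_Int[OF finite_H finite_N] card_H card_N card_HN by simp

text \<open>
  Only the two elements \<open>s\<close> and \<open>inv s\<close> can be missing from \<open>H\<close>, so the coset of \<open>H\<close> through a product \<open>a \<otimes> b\<close>
  outside \<open>near\<close> contributes 46 elements outside \<open>near\<close>, of which at most 32 are in \<open>far\<close>.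
\<close>
lemma triple_product_exchange:
  assumes nf: "\<not> far \<subseteq> near" and s: "s \<in> H \<union> N" "s \<noteq> \<one>" and y: "y \<in> carrier G" "y \<notin> H \<union> N"
    and T: "T = (H \<union> N - {s, inv s}) \<union> {y, inv y}"
  shows "card ((H \<union> N) <#> (H \<union> N) <#> (H \<union> N)) + 14 \<le> card (T <#> T <#> T)"
proof -
  let ?T3 = "T <#> T <#> T"
  have sc: "s \<in> carrier G" using s by auto
  have T3: "z \<in> ?T3" if "a \<in> T" "b \<in> T" "c \<in> T" "z = a \<otimes> b \<otimes> c" for z a b c
    using that by (auto simp: set_mult_def)
  have in_T: "z \<in> T" if "z \<in> H \<union> N" "z \<notin> {s, inv s}" for z using that T by auto
  have one_T: "\<one> \<in> T" using s sc by (intro in_T) (auto simp: inv_eq_1_iff eq_commute[of \<one>])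
  have finite_T3: "finite ?T3"
    using finite_H finite_N by (auto simp: T set_mult_def)
  obtain t where t: "t \<in> N - H" "t \<notin> {s, inv s}"
    using exists_outside_four[of "N - H" s "inv s"] card_diffs by auto
  have t_T: "t \<in> T" using t by (intro in_T) auto
  have near_T3: "near \<subseteq> ?T3"
  proof
    fix z assume "z \<in> near"
    then show "z \<in> ?T3"
    proof (rule near_cases[OF _ t(1)])
      assume z: "z \<in> H"
      obtain a where a: "a \<in> H" "\<one> \<otimes> (\<one> \<otimes> a \<otimes> inv \<one>) \<notin> {s, inv s}" "inv a \<otimes> z \<notin> {s, inv s}"
        using four_translates_avoided[of H s \<one> z \<one>] sc z by (auto simp: card_H)
      then have "a \<in> T" "inv a \<otimes> z \<in> T" using z by (auto intro!: in_T)
      then show "z \<in> ?T3" using z one_T a(1) by (intro T3[of a "inv a \<otimes> z" \<one>]) auto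
    next
      fix a b assume ab: "a \<in> H" "b \<in> H" "z = a \<otimes> t \<otimes> b"
      obtain l where l: "l \<in> H \<inter> N" "a \<otimes> (t \<otimes> l \<otimes> inv t) \<notin> {s, inv s}" "inv l \<otimes> b \<notin> {s, inv s}"
        using four_translates_avoided[of "H \<inter> N" s a b t] sc ab t by (auto simp: card_HN)
      have "t \<otimes> l \<in> N - H" using l t mult_notin_H by auto
      then obtain k where k: "k \<in> H \<inter> N" "t \<otimes> l = k \<otimes> t" using t diff_left by blast
      have k': "t \<otimes> l \<otimes> inv t = k" unfolding k(2) using k(1) t by (simp add: m_assoc)
      have "k \<otimes> (t \<otimes> (inv l \<otimes> b)) = t \<otimes> (l \<otimes> (inv l \<otimes> b))"
        using k l t ab by (intro mult_eq_mult_assoc) auto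
      then have "z = (a \<otimes> k) \<otimes> t \<otimes> (inv l \<otimes> b)"
        using ab k(1) l(1) t by (simp add: m_assoc)
      moreover have "a \<otimes> k \<in> T" "inv l \<otimes> b \<in> T"
        using l k(1) ab by (auto simp: k' intro!: in_T)
      ultimately show "z \<in> ?T3" using t_T T3 by blast
    qed
  qed
  have far_T3: "far \<subseteq> ?T3"
  proof
    fix z assume "z \<in> far"
    show "z \<in> ?T3"
    proof (cases "z \<in> near")
      case False
      then obtain h where h: "h \<in> H - N" "z = t \<otimes> h \<otimes> t"
        using \<open>z \<in> far\<close> far_diff_near t by blast
      show ?thesis
      proof (cases "h \<in> {s, inv s}")
        case False
        then have "h \<in> T" using h by (intro in_T) auto
        then show ?thesis using h t_T by (intro T3[of t h t])
      next
        case True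
        \<comment> \<open>Now the removed pair lies in \<open>H\<close>, so \<open>N - H\<close> is untouched and the left factor \<open>t\<close> may be changed.\<close>
        then have sH: "s \<in> H" "inv s \<in> H" using h sc H_closed(3)[of s] H_closed(3)[of "inv s"] by auto
        obtain l where l: "l \<in> H \<inter> N" "inv l \<otimes> h \<notin> {s, inv s}"
          using four_translates_avoided[of "H \<inter> N" s \<one> h \<one>] sc h by (auto simp: card_HN)
        have tl: "t \<otimes> l \<in> N - H" using l t mult_notin_H by auto
        have "z = t \<otimes> l \<otimes> (inv l \<otimes> h) \<otimes> t" using h l t by (simp add: m_assoc)
        moreover have "t \<otimes> l \<in> T" using tl sH by (intro in_T) auto
        moreover have "inv l \<otimes> h \<in> T" using l h by (intro in_T) auto
        ultimately show ?thesis using t_T T3 by blast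
      qed
    qed (use near_T3 in blast)
  qed
  obtain a b where g: "a \<in> {\<one>, t}" "b \<in> {y, inv y}" "a \<otimes> b \<in> carrier G - near"
    using product_outside_near[OF nf t(1) y] .
  have abc: "a \<in> carrier G" "b \<in> carrier G" using g t y by auto
  define X where "X = (\<lambda>h. h \<otimes> (a \<otimes> b)) ` (H - {s, inv s})"
  have "46 \<le> card (H - {s, inv s})"
    using diff_card_le_card_Diff[of "{s, inv s}" H] card_length[of "[s, inv s]"] card_H by simp
  also have "\<dots> = card X"
    unfolding X_def using g by (intro card_image[symmetric]) (auto simp: inj_on_def)
  finally have card_X: "46 \<le> card X" .
  have X_near: "X \<inter> near = {}"
    using g near_mult_left_iff by (auto simp: X_def)
  have "a \<in> T" "b \<in> T" using g one_T t_T by (auto simp: T)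
  then have X_T3: "X \<subseteq> ?T3"
    using abc by (auto simp: X_def m_assoc intro!: T3[of _ a b] in_T)
  have finX: "finite X" using finite_H by (simp add: X_def)
  have "card X \<le> card ((X - far) \<union> (far - near))"
    using finX finite_far X_near by (intro card_mono) auto
  also have "\<dots> \<le> card (X - far) + 32"
    using card_Un_le[of "X - far" "far - near"] card_far_diff_near by linarith
  finally have "14 \<le> card (X - far)" using card_X by simp
  moreover have "card (near \<union> far) + card (X - far) = card (near \<union> far \<union> (X - far))"
    using finX finite_near finite_far X_near by (intro card_Un_disjoint[symmetric]) auto
  moreover have "\<dots> \<le> card ?T3"
    using near_T3 far_T3 X_T3 finite_T3 by (intro card_mono) auto
  moreover have "card ((H \<union> N) <#> (H \<union> N) <#> (H \<union> N)) \<le> card (near \<union> far)"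
    using triple_product finite_near finite_far by (intro card_mono) auto
  ultimately show ?thesis by linarith
qed

end

text \<open>
  Since \<open>n \<le> 64\<^sup>2\<close>, enlarging the base of the logarithm from 64 to 65 is compensated by
  multiplying \<open>n\<close> with \<open>(65/64)\<^sup>2\<close>, which adds less than 8 because \<open>n \<le> 224\<close>.
\<close>
lemma ln_ratio_less:
  fixes n m k :: nat
  assumes n: "1 \<le> n" "n \<le> 224" and m: "n + 14 \<le> m" and k: "2 \<le> k" "k \<le> 65"
  shows "ln (real n) / ln 64 < ln (real m) / ln (real k)"
proof -
  have "ln (real n) \<le> ln (64 ^ 2)" using n by (subst ln_le_cancel_iff) auto
  then have n_le: "ln (real n) \<le> 2 * ln 64"
    by (simp only: ln_realpow of_nat_numeral)
  have "ln (real n) * ln (real k) \<le> ln (real n) * ln 65"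
    using k n by (intro mult_left_mono) auto
  also have "\<dots> = ln (real n) * ln 64 + ln (real n) * ln (65/64)"
    by (simp add: ln_div algebra_simps)
  also have "\<dots> \<le> ln (real n) * ln 64 + 2 * ln 64 * ln (65/64)"
    using n_le by (intro add_left_mono mult_right_mono) auto
  also have "\<dots> = ln 64 * ln (real n * (65/64)^2)"
    using n by (simp add: ln_mult ln_realpow algebra_simps)
  also have "\<dots> < ln 64 * ln (real m)"
  proof (intro mult_strict_left_mono)
    have "real n * (65/64)^2 < real n + 14" using n by (simp add: power2_eq_square)
    also have "\<dots> \<le> real m" using m by simp
    finally show "ln (real n * (65/64)^2) < ln (real m)" using n m by (subst ln_less_cancel_iff) auto
  qed simp
  finally show ?thesis using k by (simp add: divide_simps mult.commute)
qed

lemma (in cubic_amalgam) triple_growth_exchange: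
  assumes "\<not> far \<subseteq> near" and "s \<in> H \<union> N" "s \<noteq> \<one>" and "y \<in> carrier G" "y \<notin> H \<union> N"
    and T: "T = (H \<union> N - {s, inv s}) \<union> {y, inv y}"
  shows "triple_growth G (H \<union> N) < triple_growth G T"
proof -
  have fin: "finite T" using finite_H finite_N by (simp add: T)
  have "card (H \<union> N - {s, inv s}) \<le> card (H \<union> N - {s})"
    using finite_H finite_N by (intro card_mono) auto
  also have "\<dots> = 63" using card_Diff_singleton[OF assms(2)] card_union by simp
  finally have "card (H \<union> N - {s, inv s}) \<le> 63" .
  moreover have "card {y, inv y} \<le> 2" using card_length[of "[y, inv y]"] by simp
  ultimately have T_le: "card T \<le> 65"
    unfolding T using card_Un_le[of "H \<union> N - {s, inv s}" "{y, inv y}"] by linarith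
  have "card (H \<union> N) - 2 \<le> card (H \<union> N - {s, inv s})"
    using diff_card_le_card_Diff[of "{s, inv s}" "H \<union> N"] card_length[of "[s, inv s]"] by simp
  also have "\<dots> \<le> card T" using fin unfolding T by (intro card_mono) auto
  finally have T_ge: "2 \<le> card T" using card_union by simp
  have "\<one> \<otimes> \<one> \<otimes> \<one> \<in> (H \<union> N) <#> (H \<union> N) <#> (H \<union> N)"
    unfolding set_mult_def by blast
  then have "1 \<le> card ((H \<union> N) <#> (H \<union> N) <#> (H \<union> N))"
    using finite_subset[OF triple_product] finite_near finite_far
    by (auto simp: Suc_le_eq card_gt_0_iff)
  then show ?thesis
    unfolding triple_growth_def
    using ln_ratio_less[OF _ card_triple_product triple_product_exchange[OF assms] T_ge T_le] card_union by simp
qed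


section \<open>The amalgam of a subgroup and an element squaring into it\<close>

text \<open>
  Write \<open>L\<close> for \<open>x\<inverse>Hx \<inter> H\<close>. Because \<open>x\<^sup>2 \<in> H\<close>, conjugation by \<open>x\<close> exchanges \<open>H\<close> and \<open>x\<inverse>Hx\<close>, so it
  preserves \<open>L\<close>; therefore \<open>E = xL\<close> and \<open>L \<union> E\<close> is closed under products.
\<close>
lemma (in group) cubic_amalgam_of_index_three:
  assumes H: "subgroup H G" "card H = 48" and x: "x \<in> carrier G" "x \<otimes> x \<in> H"
    and index: "card (rcosets\<^bsub>G\<lparr>carrier := H\<rparr>\<^esub> ((inv x <# H #> x) \<inter> H)) = 3"
  defines "E \<equiv> (x <# H) \<inter> (H #> x)"
  defines "N \<equiv> ((inv x <# H #> x) \<inter> H) \<union> E"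
  shows "cubic_amalgam G H N" and "H \<union> N = H \<union> E" and "x \<in> N"
proof -
  define L where "L = (inv x <# H #> x) \<inter> H"
  have Hc [simp, intro]: "a \<in> carrier G" if "a \<in> H" for a
    using subgroup.mem_carrier[OF H(1) that] .
  have Hm [simp, intro]: "a \<otimes> b \<in> H" if "a \<in> H" "b \<in> H" for a b
    using subgroup.m_closed[OF H(1) that] .
  have Hi [simp, intro]: "inv a \<in> H" if "a \<in> H" for a
    using subgroup.m_inv_closed[OF H(1) that] .
  have H1 [simp]: "\<one> \<in> H" using subgroup.one_closed[OF H(1)] .
  have finH: "finite H" using H(2) by (auto intro: card_ge_0_finite)
  have L_iff: "l \<in> L \<longleftrightarrow> l \<in> H \<and> x \<otimes> l \<otimes> inv x \<in> H" for l
  proof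
    assume "l \<in> L"
    then obtain h where h: "h \<in> H" "l = inv x \<otimes> h \<otimes> x" "l \<in> H"
      by (auto simp: L_def l_coset_def r_coset_def)
    have "x \<otimes> l \<otimes> inv x = h" unfolding h(2) using h(1) x by (simp add: m_assoc)
    then show "l \<in> H \<and> x \<otimes> l \<otimes> inv x \<in> H" using h by simp
  next
    assume l: "l \<in> H \<and> x \<otimes> l \<otimes> inv x \<in> H"
    then have "l = inv x \<otimes> (x \<otimes> l \<otimes> inv x) \<otimes> x" using x by (simp add: m_assoc)
    then show "l \<in> L" using l unfolding L_def l_coset_def r_coset_def by blast
  qed
  have E_iff: "e \<in> E \<longleftrightarrow> e \<in> carrier G \<and> inv x \<otimes> e \<in> H \<and> e \<otimes> inv x \<in> H" for e
  proof
    assume "e \<in> E"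
    then obtain h k where hk: "h \<in> H" "e = x \<otimes> h" "k \<in> H" "e = k \<otimes> x"
      by (auto simp: E_def l_coset_def r_coset_def)
    have "inv x \<otimes> e = h" unfolding hk(2) using hk(1) x by simp
    moreover have "e \<otimes> inv x = k" unfolding hk(4) using hk(3) x by (simp add: m_assoc)
    ultimately show "e \<in> carrier G \<and> inv x \<otimes> e \<in> H \<and> e \<otimes> inv x \<in> H" using hk x by simp
  next
    assume e: "e \<in> carrier G \<and> inv x \<otimes> e \<in> H \<and> e \<otimes> inv x \<in> H"
    then have "e = x \<otimes> (inv x \<otimes> e)" "e = e \<otimes> inv x \<otimes> x" using x by (simp_all add: m_assoc)
    then show "e \<in> E" using e unfolding E_def l_coset_def r_coset_def by blast
  qed
  have xx: "inv x \<otimes> inv x \<in> H" using Hi[OF x(2)] x(1) by (simp add: inv_mult_group)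
  have N_iff: "g \<in> N \<longleftrightarrow> g \<in> L \<or> g \<in> E" for g by (simp add: N_def L_def)
  have L_conj: "inv x \<otimes> l \<otimes> x \<in> H" if "l \<in> L" for l
  proof -
    have "(inv x \<otimes> inv x) \<otimes> (x \<otimes> l \<otimes> inv x) \<otimes> (x \<otimes> x) \<in> H"
      using that xx x(2) L_iff by blast
    moreover have "(inv x \<otimes> inv x) \<otimes> (x \<otimes> l \<otimes> inv x) \<otimes> (x \<otimes> x) = inv x \<otimes> l \<otimes> x"
      using that x(1) L_iff by (simp add: m_assoc)
    ultimately show ?thesis by simp
  qed
  have LL: "a \<otimes> b \<in> L" if "a \<in> L" "b \<in> L" for a b
  proof -
    have "(x \<otimes> a \<otimes> inv x) \<otimes> (x \<otimes> b \<otimes> inv x) \<in> H" using that L_iff by blast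
    moreover have "(x \<otimes> a \<otimes> inv x) \<otimes> (x \<otimes> b \<otimes> inv x) = x \<otimes> (a \<otimes> b) \<otimes> inv x"
      using that x(1) L_iff by (simp add: m_assoc)
    ultimately show ?thesis using that L_iff by simp
  qed
  have L_inv: "inv a \<in> L" if "a \<in> L" for a
  proof -
    have "inv (x \<otimes> a \<otimes> inv x) \<in> H" using that L_iff by blast
    moreover have "inv (x \<otimes> a \<otimes> inv x) = x \<otimes> inv a \<otimes> inv x"
      using that x(1) L_iff by (simp add: m_assoc inv_mult_group)
    ultimately show ?thesis using that L_iff by simp
  qed
  have LE: "a \<otimes> e \<in> E" if "a \<in> L" "e \<in> E" for a e
  proof -
    have "(inv x \<otimes> a \<otimes> x) \<otimes> (inv x \<otimes> e) \<in> H" "a \<otimes> (e \<otimes> inv x) \<in> H"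
      using that L_conj L_iff E_iff by blast+
    moreover have "(inv x \<otimes> a \<otimes> x) \<otimes> (inv x \<otimes> e) = inv x \<otimes> (a \<otimes> e)"
      using that x(1) L_iff E_iff by (simp add: m_assoc)
    ultimately show ?thesis using that x(1) L_iff E_iff by (simp add: m_assoc)
  qed
  have E_inv: "inv e \<in> E" if "e \<in> E" for e
  proof -
    have "inv ((e \<otimes> inv x) \<otimes> (x \<otimes> x)) \<in> H" "inv ((x \<otimes> x) \<otimes> (inv x \<otimes> e)) \<in> H"
      using that x(2) E_iff by blast+
    moreover have "inv ((e \<otimes> inv x) \<otimes> (x \<otimes> x)) = inv x \<otimes> inv e"
        "inv ((x \<otimes> x) \<otimes> (inv x \<otimes> e)) = inv e \<otimes> inv x"
      using that x(1) E_iff by (simp_all add: m_assoc inv_mult_group)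
    ultimately show ?thesis using that E_iff by simp
  qed
  have EL: "e \<otimes> a \<in> E" if "a \<in> L" "e \<in> E" for a e
    using E_inv[OF LE[OF L_inv[OF that(1)] E_inv[OF that(2)]]] that L_iff E_iff
    by (simp add: inv_mult_group)
  have EE: "e \<otimes> f \<in> L" if "e \<in> E" "f \<in> E" for e f
  proof -
    have "(e \<otimes> inv x) \<otimes> (x \<otimes> x) \<otimes> (inv x \<otimes> f) \<in> H" "(x \<otimes> x) \<otimes> (inv x \<otimes> e) \<otimes> (f \<otimes> inv x) \<in> H"
      using that x(2) E_iff by blast+
    moreover have "(e \<otimes> inv x) \<otimes> (x \<otimes> x) \<otimes> (inv x \<otimes> f) = e \<otimes> f"
        "(x \<otimes> x) \<otimes> (inv x \<otimes> e) \<otimes> (f \<otimes> inv x) = x \<otimes> (e \<otimes> f) \<otimes> inv x"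
      using that x(1) E_iff by (simp_all add: m_assoc)
    ultimately show ?thesis using L_iff by simp
  qed
  have L1: "\<one> \<in> L" using x L_iff by simp
  have L_sub: "L \<subseteq> H" using L_iff by blast
  have sub_L: "subgroup L G"
    using LL L_inv L1 L_sub by (intro subgroupI) auto
  have "card (rcosets\<^bsub>G\<lparr>carrier := H\<rparr>\<^esub> L) * card L = card H"
    using lagrange_within[OF sub_L H(1) L_sub] .
  then have card_L: "card L = 16" using index H(2) by (simp add: L_def)
  have "x \<notin> H"
  proof
    assume "x \<in> H"
    then have "L = H" using L_iff by auto
    then show False using card_L H(2) by simp
  qed
  have E_eq: "E = (\<lambda>l. x \<otimes> l) ` L"
  proof (intro equalityI subsetI)
    fix e assume "e \<in> E"
    then have "e = x \<otimes> (inv x \<otimes> e)" "inv x \<otimes> e \<in> L" using x(1) E_iff L_iff by (auto simp: m_assoc)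
    then show "e \<in> (\<lambda>l. x \<otimes> l) ` L" by blast
  next
    fix e assume "e \<in> (\<lambda>l. x \<otimes> l) ` L"
    then show "e \<in> E" using x(1) E_iff L_iff by auto
  qed
  have card_E: "card E = 16"
    unfolding E_eq card_L[symmetric] using x(1) by (intro card_image) (auto simp: inj_on_def L_iff)
  have "E \<inter> H = {}"
  proof -
    have False if e: "e \<in> E" "e \<in> H" for e
    proof -
      have "e \<otimes> inv (inv x \<otimes> e) \<in> H" using e E_iff by blast
      moreover have "e \<otimes> inv (inv x \<otimes> e) = x" using e x(1) by (simp add: inv_mult_group)
      ultimately show False using \<open>x \<notin> H\<close> by simp
    qed
    then show ?thesis by blast
  qed
  then have HN: "H \<inter> N = L" and "L \<inter> E = {}" using L_sub by (auto simp: N_iff)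
  have N_eq: "N = L \<union> E" using N_iff by auto
  have "card N = 32"
    unfolding N_eq using \<open>L \<inter> E = {}\<close> card_L card_E
    by (subst card_Un_disjoint) (auto intro: card_ge_0_finite)
  moreover have "subgroup N G"
  proof (rule subgroupI)
    show "N \<subseteq> carrier G" using L_sub E_iff by (auto simp: N_iff)
    show "N \<noteq> {}" using L1 N_iff by auto
  qed (use LL LE EL EE L_inv E_inv N_iff in auto)
  ultimately show "cubic_amalgam G H N"
    using H card_L HN by (intro cubic_amalgam.intro cubic_amalgam_axioms.intro is_group) auto
  show "H \<union> N = H \<union> E" using L_sub by (auto simp: N_iff)
  show "x \<in> N" using x N_iff E_iff by simp
qed

section \<open>Orders in the special linear group\<close>

lemma card_PSL2_preimage:
  fixes K :: "('a::{field, finite} ^ 2 ^ 2) set set"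
  assumes "subgroup K PSL2"
  shows "card (PSL2_preimage K) = card (SL2_scalars :: ('a ^ 2 ^ 2) set) * card K"
proof -
  interpret group "SL2 :: ('a ^ 2 ^ 2) monoid" by (rule group_SL2)
  have scal: "subgroup SL2_scalars (SL2 :: ('a ^ 2 ^ 2) monoid)"
    by (rule normal_imp_subgroup[OF normal_SL2_scalars])
  have scal_sub: "SL2_scalars \<subseteq> carrier (SL2 :: ('a ^ 2 ^ 2) monoid)"
    by (rule subgroup.subset[OF scal])
  have K: "c \<in> rcosets\<^bsub>SL2\<^esub> SL2_scalars" if "c \<in> K" for c
    using subgroup.subset[OF assms] that by (auto simp: PSL2_def FactGroup_def)
  have "PSL2_preimage K = \<Union>K"
  proof (intro equalityI subsetI)
    fix A assume "A \<in> PSL2_preimage K"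
    then show "A \<in> \<Union>K"
      using rcos_self[OF _ scal, of A] by (auto simp: PSL2_preimage_def)
  next
    fix A assume "A \<in> \<Union>K"
    then obtain c where c: "c \<in> K" "A \<in> c" by auto
    then obtain B where B: "B \<in> carrier SL2" "c = SL2_scalars #>\<^bsub>SL2\<^esub> B"
      using K[OF c(1)] by (auto simp: RCOSETS_def simp del: SL2_simps)
    then have "A \<in> carrier SL2" using c r_coset_subset_G[OF scal_sub B(1)] by blast
    moreover have "SL2_scalars #>\<^bsub>SL2\<^esub> A = c"
      using repr_independence[OF _ B(1) scal, of A] c B by simp
    ultimately show "A \<in> PSL2_preimage K" using c by (simp add: PSL2_preimage_def)
  qed
  moreover have "card (SL2_scalars :: ('a ^ 2 ^ 2) set) * card K = card (\<Union>K)"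
  proof (rule card_partition)
    show "card c = card (SL2_scalars :: ('a ^ 2 ^ 2) set)" if "c \<in> K" for c
      using card_rcosets_equal[OF K[OF that] scal_sub] by simp
    show "c \<inter> d = {}" if "c \<in> K" "d \<in> K" "c \<noteq> d" for c d
      using rcos_disjoint[OF scal] K[OF that(1)] K[OF that(2)] that(3)
      by (auto simp: pairwise_def disjnt_def)
  qed auto
  ultimately show ?thesis by simp
qed

lemma card_prime_matrices: "CARD('p::prime_card mod_ring ^ 2 ^ 2) = CARD('p) ^ 4"
  by (simp flip: power_mult)

lemma card_SL2_scalars:
  assumes "CARD('p::prime_card) \<noteq> 2"
  shows "card (SL2_scalars :: ('p mod_ring ^ 2 ^ 2) set) = 2"
proof -
  have "mat 1 \<noteq> (- mat 1 :: 'p mod_ring ^ 2 ^ 2)"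
  proof
    assume "mat 1 = (- mat 1 :: 'p mod_ring ^ 2 ^ 2)"
    then have "(mat 1 :: 'p mod_ring ^ 2 ^ 2) $ 1 $ 1 = (- mat 1 :: 'p mod_ring ^ 2 ^ 2) $ 1 $ 1" by metis
    then have "(1 :: 'p mod_ring) = - 1" by (simp add: mat_def)
    then have "of_nat 2 = (0 :: 'p mod_ring)" by (simp add: eq_neg_iff_add_eq_0)
    then have "CARD('p) dvd 2" by (rule of_nat_0_mod_ring_dvd)
    then show False using assms prime_card[where 'a='p]
      by (metis primes_dvd_imp_eq two_is_prime_nat)
  qed
  then show ?thesis by (simp add: SL2_scalars_def)
qed

text \<open>
  In characteristic 2 the scalars coincide, but then there are only 16 matrices, too few for a
  subgroup of the quotient isomorphic to the symmetric group of order 24.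
\<close>
lemma card_double_cover_S4:
  fixes H :: "('p::prime_card mod_ring ^ 2 ^ 2) set"
  assumes "is_double_cover_S4 H"
  shows "card H = 48"
proof -
  obtain K :: "('p mod_ring ^ 2 ^ 2) set set" where K: "subgroup K PSL2"
      "PSL2\<lparr>carrier := K\<rparr> \<cong> sym_group 4" "SL2\<lparr>carrier := H\<rparr> \<cong> SL2\<lparr>carrier := PSL2_preimage K\<rparr>"
    using assms by (auto simp: is_double_cover_S4_def)
  have card_K: "card K = 24"
    using iso_same_card[OF K(2)] by (simp add: sym_group_card_carrier fact_numeral)
  have card_H: "card H = card (SL2_scalars :: ('p mod_ring ^ 2 ^ 2) set) * 24"
    using iso_same_card[OF K(3)] card_PSL2_preimage[OF K(1)] card_K by simp
  have p: "CARD('p) \<noteq> 2"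
  proof
    assume "CARD('p) = 2"
    moreover have "card H \<le> CARD('p mod_ring ^ 2 ^ 2)" by (intro card_mono) auto
    moreover have "0 < card (SL2_scalars :: ('p mod_ring ^ 2 ^ 2) set)"
      by (simp add: SL2_scalars_def card_gt_0_iff)
    ultimately show False unfolding card_prime_matrices using card_H by simp
  qed
  show "card H = 48" using card_H card_SL2_scalars[OF p] by simp
qed

definition unipotent :: "'a::field \<Rightarrow> 'a ^ 2 ^ 2" where
  "unipotent a = (\<chi> i j. if i = j then 1 else if i = 1 then a else 0)"

lemma CARD_dvd_order_SL2: "CARD('p::prime_card) dvd Coset.order (SL2 :: ('p mod_ring ^ 2 ^ 2) monoid)"
proof -
  interpret group "SL2 :: ('p mod_ring ^ 2 ^ 2) monoid" by (rule group_SL2)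
  have mult: "unipotent a ** unipotent b = unipotent (a + b)" for a b :: "'p mod_ring"
    by (simp add: unipotent_def vec_eq_iff forall_2 matrix_matrix_mult_def sum_2 add.commute)
  have det: "det (unipotent a) = 1" for a :: "'p mod_ring"
    by (simp add: unipotent_def det_2)
  have zero: "unipotent 0 = (mat 1 :: 'p mod_ring ^ 2 ^ 2)"
    by (simp add: unipotent_def vec_eq_iff mat_def)
  have inverse: "inv\<^bsub>SL2\<^esub> (unipotent a) = unipotent (- a)" for a :: "'p mod_ring"
    by (rule inv_equality) (simp_all add: mult det zero)
  have "subgroup (range unipotent) (SL2 :: ('p mod_ring ^ 2 ^ 2) monoid)"
    by (rule subgroupI) (auto simp: mult det inverse)
  then have "card (range (unipotent :: 'p mod_ring \<Rightarrow> _)) dvd Coset.order (SL2 :: ('p mod_ring ^ 2 ^ 2) monoid)"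
    using lagrange by (metis dvd_triv_right)
  moreover have "inj (unipotent :: 'p mod_ring \<Rightarrow> _)"
    by (auto simp: inj_def unipotent_def vec_eq_iff forall_2)
  ultimately show ?thesis by (simp add: card_image)
qed

text \<open>
  An order of 96 or 192 would leave only \<open>p = 2\<close> and \<open>p = 3\<close>, the primes dividing it, and for these there are at
  most 81 matrices altogether.
\<close>
lemma order_SL2_gt_192:
  assumes "96 dvd Coset.order (SL2 :: ('p::prime_card mod_ring ^ 2 ^ 2) monoid)"
  shows "192 < Coset.order (SL2 :: ('p mod_ring ^ 2 ^ 2) monoid)"
proof (rule ccontr)
  assume le: "\<not> ?thesis"
  have pos: "0 < Coset.order (SL2 :: ('p mod_ring ^ 2 ^ 2) monoid)"
    using monoid.one_closed[OF group.is_monoid[OF group_SL2]]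
    by (auto simp: Coset.order_def card_gt_0_iff simp del: SL2_simps)
  have "Coset.order (SL2 :: ('p mod_ring ^ 2 ^ 2) monoid) dvd 2 ^ 6 * 3"
  proof -
    obtain k where k: "Coset.order (SL2 :: ('p mod_ring ^ 2 ^ 2) monoid) = 96 * k" using assms by blast
    then have "k = 1 \<or> k = 2" using le pos by linarith
    then show ?thesis using k by auto
  qed
  then have "CARD('p) dvd 2 ^ 6 * 3" using CARD_dvd_order_SL2 dvd_trans by blast
  then have "CARD('p) dvd 2 \<or> CARD('p) dvd 3"
    using prime_card[where 'a='p] by (metis prime_dvd_mult_iff prime_dvd_power)
  then have "CARD('p) \<le> 3" by (auto dest: dvd_imp_le)
  then have "CARD('p) ^ 4 \<le> 3 ^ 4" by (rule power_mono) simp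
  moreover have "Coset.order (SL2 :: ('p mod_ring ^ 2 ^ 2) monoid) \<le> CARD('p mod_ring ^ 2 ^ 2)"
    unfolding Coset.order_def by (intro card_mono) auto
  moreover have "96 \<le> Coset.order (SL2 :: ('p mod_ring ^ 2 ^ 2) monoid)"
    using assms pos by (rule dvd_imp_le)
  ultimately show False unfolding card_prime_matrices by simp
qed

section \<open>Exchange strictly increases tripling\<close>

theorem corollary7p3:
  fixes H S T :: "('p::prime_card mod_ring ^ 2 ^ 2) set"
    and x s y :: "'p mod_ring ^ 2 ^ 2"
  assumes "subgroup H SL2"
    and "is_double_cover_S4 H"
    and "x \<in> carrier SL2"
    and "generate SL2 (H \<union> {x}) = carrier SL2"
    and "x \<otimes>\<^bsub>SL2\<^esub> x \<in> H"
    and "card (rcosets\<^bsub>SL2\<lparr>carrier := H\<rparr>\<^esub> ((inv\<^bsub>SL2\<^esub> x <#\<^bsub>SL2\<^esub> H #>\<^bsub>SL2\<^esub> x) \<inter> H)) = 3"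
    and "S = H \<union> ((x <#\<^bsub>SL2\<^esub> H) \<inter> (H #>\<^bsub>SL2\<^esub> x))"
    and "s \<in> S" and "s \<noteq> \<one>\<^bsub>SL2\<^esub>"
    and "y \<in> carrier SL2 - S"
    and "T = (S - {s, inv\<^bsub>SL2\<^esub> s}) \<union> {y, inv\<^bsub>SL2\<^esub> y}"
  shows "triple_growth SL2 T > triple_growth SL2 S"
proof -
  let ?E = "(x <#\<^bsub>SL2\<^esub> H) \<inter> (H #>\<^bsub>SL2\<^esub> x)"
  let ?N = "((inv\<^bsub>SL2\<^esub> x <#\<^bsub>SL2\<^esub> H #>\<^bsub>SL2\<^esub> x) \<inter> H) \<union> ?E"
  interpret group "SL2 :: ('p mod_ring ^ 2 ^ 2) monoid" by (rule group_SL2)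
  note amalgam = cubic_amalgam_of_index_three[OF assms(1) card_double_cover_S4[OF assms(2)] assms(3,5,6)]
  interpret cubic_amalgam SL2 H ?N by (rule amalgam(1))
  have S: "H \<union> ?N = S" using amalgam(2) assms(7) by simp
  have "\<not> far \<subseteq> near"
  proof
    assume "far \<subseteq> near"
    have "generate SL2 (H \<union> {x}) \<subseteq> generate SL2 (H \<union> ?N)"
      using amalgam(3) by (intro mono_generate) auto
    moreover have "generate SL2 (H \<union> ?N) \<subseteq> carrier SL2"
      using H_closed(1) N_closed(1) by (intro generate_incl) blast
    ultimately have "carrier SL2 = near"
      using carrier_eq_near[OF \<open>far \<subseteq> near\<close>] assms(4) by auto
    then have "Coset.order (SL2 :: ('p mod_ring ^ 2 ^ 2) monoid) \<le> 192"
      using card_near by (simp add: Coset.order_def del: SL2_simps)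
    moreover have "48 dvd Coset.order (SL2 :: ('p mod_ring ^ 2 ^ 2) monoid)"
        "32 dvd Coset.order (SL2 :: ('p mod_ring ^ 2 ^ 2) monoid)"
      using lagrange[OF subgroup_H] lagrange[OF subgroup_N] card_H card_N by (metis dvd_triv_right)+
    then have "96 dvd Coset.order (SL2 :: ('p mod_ring ^ 2 ^ 2) monoid)" by presburger
    ultimately show False using order_SL2_gt_192 by fastforce
  qed
  then show ?thesis
    using triple_growth_exchange[of s y T] assms(8-11) unfolding S by blast
qed

end
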